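(* Consider an irreducible finite Markov chain with $n$ states indexed by $i=1,2,\dots,n$, with invariant distribution $\pi=(\pi_i)$ and fundamental matrix $Z$. Let $S\subset\{1,2,\dots,n\}$ be a subset of states. The mean time $\tau(i\to S)$ to reach $S$ starting at an initial state $i\notin S$ is given by $$\tau(i\to S)=\sum_{k\in S}(Z_{kj}-Z_{ki})\,\tau(k\to S),\qquad \text{for every } j\in S,\ i\notin S.$$ In particular, the sum $\sum_{k\in S}Z_{kj}\,\tau(k\to S)$ is independent of the chosen state $j\in S$.
   Context: The chain has a stochastic matrix $\mathcal{P}=(p_{ij})$ acting on column vectors: $p_{ij}\ge0$ is the probability of a one-step transition from state $j$ to state $i$, so each column of $\mathcal{P}$ sums to 1. Irreducible means that any state can be reached from any other with positive probability in some number of steps. The invariant distribution $\pi$ is the unique probability vector (column) with $\mathcal{P}\pi=\pi$; it has $\pi_i>0$ for all $i$. The fundamental matrix is $Z=(I-\mathcal{P}+\Omega)^{-1}$, where $I$ is the $n\times n$ identity matrix and $\Omega=\pi\mathbf{1}^T$ is the matrix all of whose columns equal $\pi$ (this inverse exists). For any state $i$ (in $S$ or not) and the chain $(X_r)_{r\ge0}$ with $X_0=i$, $\tau(i\to S)$ is the expected value of $\min\{r\ge1: X_r\in S\}$; for $k\in S$, $\tau(k\to S)$ is thus the mean return time to $S$ starting from $k$. *)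

theory Defs
  imports "HOL-Probability.Probability"
begin

text \<open>
  Matrices act on column vectors: for \<open>P :: real^'n^'n\<close> the entry \<open>P $ i $ j\<close> is the probability of a
  one-step transition from state \<open>j\<close> to state \<open>i\<close>, so the columns of \<open>P\<close> sum to 1.
\<close>

definition stochastic_matrix :: "real^'n^'n \<Rightarrow> bool" where
  "stochastic_matrix P \<longleftrightarrow> (\<forall>i j. 0 \<le> P $ i $ j) \<and> (\<forall>j. (\<Sum>i\<in>UNIV. P $ i $ j) = 1)"

text \<open>
  The power \<open>A ^ r\<close> of the library is taken componentwise on vectors, hence a separate notion for
  iterated matrix products.
\<close>

definition matrix_power :: "real^'n^'n \<Rightarrow> nat \<Rightarrow> real^'n^'n" where
  "matrix_power A r = ((\<lambda>B. A ** B) ^^ r) (mat 1)"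

definition irreducible_chain :: "real^'n^'n \<Rightarrow> bool" where
  "irreducible_chain P \<longleftrightarrow> (\<forall>i j. \<exists>r. 0 < matrix_power P r $ i $ j)"

definition invariant_distribution :: "real^'n^'n \<Rightarrow> real^'n \<Rightarrow> bool" where
  "invariant_distribution P \<pi> \<longleftrightarrow>
     (\<forall>i. 0 \<le> \<pi> $ i) \<and> (\<Sum>i\<in>UNIV. \<pi> $ i) = 1 \<and> P *v \<pi> = \<pi>"

definition fundamental_matrix :: "real^'n^'n \<Rightarrow> real^'n \<Rightarrow> real^'n^'n" where
  "fundamental_matrix P \<pi> = matrix_inv (mat 1 - P + (\<chi> i j. \<pi> $ i))"

text \<open>
  The last clause is the Markov property: given any past trajectory \<open>x 0, \<dots>, x r\<close> of positive
  probability, the next state is distributed as column \<open>x r\<close> of \<open>P\<close>.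
\<close>

definition markov_chain_from ::
    "real^'n^'n \<Rightarrow> 'n \<Rightarrow> 'w measure \<Rightarrow> (nat \<Rightarrow> 'w \<Rightarrow> 'n) \<Rightarrow> bool" where
  "markov_chain_from P i M X \<longleftrightarrow>
     prob_space M \<and>
     (\<forall>r. X r \<in> measurable M (count_space UNIV)) \<and>
     (AE \<omega> in M. X 0 \<omega> = i) \<and>
     (\<forall>r x y. \<P>(\<omega> in M. \<forall>s\<le>r. X s \<omega> = x s) > 0 \<longrightarrow>
        \<P>(\<omega> in M. X (Suc r) \<omega> = y \<bar> \<forall>s\<le>r. X s \<omega> = x s) = P $ y $ x r)"

text \<open>
  The time \<open>min {r \<ge> 1. x r \<in> S}\<close> along a single trajectory \<open>x\<close>; it is infinite if \<open>S\<close> is not visited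
  at any time \<open>r \<ge> 1\<close>. A visit at time 0 does not count.
\<close>

definition first_visit :: "'n set \<Rightarrow> (nat \<Rightarrow> 'n) \<Rightarrow> ennreal" where
  "first_visit S x =
     (if \<exists>r\<ge>1. x r \<in> S then of_nat (LEAST r. 1 \<le> r \<and> x r \<in> S) else \<infinity>)"

definition mean_time :: "'w measure \<Rightarrow> (nat \<Rightarrow> 'w \<Rightarrow> 'n) \<Rightarrow> 'n set \<Rightarrow> ennreal" where
  "mean_time M X S = (\<integral>\<^sup>+\<omega>. first_visit S (\<lambda>r. X r \<omega>) \<partial>M)"

text \<open>
  Every stochastic matrix has chains started at every state: draw independent random maps
  \<open>\<omega> 0, \<omega> 1, \<dots>\<close> on the states, where the value of each at \<open>j\<close> is distributed as column \<open>j\<close> of \<open>P\<close>, and let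
  \<open>\<omega> r\<close> perform the transition from time \<open>r\<close> to time \<open>r + 1\<close>.
\<close>

lemma markov_chain_from_exists:
  fixes P :: "real^'n^'n"
  assumes P: "stochastic_matrix P"
  shows "\<exists>(M :: (nat \<Rightarrow> 'n \<Rightarrow> 'n) measure) X. \<forall>i. markov_chain_from P i M (X i)"
proof -
  define c where "c j = embed_pmf (\<lambda>i. P $ i $ j)" for j
  have c: "pmf (c j) i = P $ i $ j" for i j
    unfolding c_def using P
    by (intro pmf_embed_pmf)
      (auto simp: stochastic_matrix_def nn_integral_count_space_finite sum_ennreal)
  define q where "q = Pi_pmf (UNIV :: 'n set) undefined c"
  have q: "measure q {f. f j = y} = P $ y $ j" for j y
  proof -
    have "map_pmf (\<lambda>f. f j) q = c j"
      unfolding q_def by (subst Pi_pmf_component) auto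
    then have "P $ y $ j = pmf (map_pmf (\<lambda>f. f j) q) y"
      by (simp add: c)
    also have "\<dots> = measure q ((\<lambda>f. f j) -` {y})"
      by (simp add: pmf_map)
    finally show ?thesis
      by (simp add: vimage_def)
  qed
  define M where "M = PiM (UNIV :: nat set) (\<lambda>_. measure_pmf q)"
  interpret q: product_prob_space "\<lambda>_::nat. measure_pmf q" UNIV
    by standard
  interpret prob_space M
    unfolding M_def by (rule prob_space_PiM) (rule prob_space_measure_pmf)
  define X where "X i r \<omega> = rec_nat i (\<lambda>s j. \<omega> s j) r" for i :: 'n and r and \<omega> :: "nat \<Rightarrow> 'n \<Rightarrow> 'n"
  have X0 [simp]: "X i 0 \<omega> = i" and XS [simp]: "X i (Suc r) \<omega> = \<omega> r (X i r \<omega>)" for i r \<omega>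
    by (simp_all add: X_def)
  have space_M [simp]: "space M = UNIV"
    by (simp add: M_def space_PiM PiE_def)
  have meas: "X i r \<in> measurable M (count_space UNIV)" for i r
  proof (induction r)
    case (Suc r)
    have "(\<lambda>\<omega>. (\<omega> r) j) \<in> measurable M (count_space UNIV)" for j
      unfolding M_def
      by (rule measurable_compose[OF measurable_component_singleton[of r]]) auto
    then have "(\<lambda>\<omega>. \<omega> r (X i r \<omega>)) \<in> measurable M (count_space UNIV)"
      by (rule measurable_compose_countable[OF _ Suc])
    then show ?case
      by simp
  qed (simp add: X_def)
  have path: "(\<forall>s\<le>r. X i s \<omega> = x s) \<longleftrightarrow> x 0 = i \<and> (\<forall>s<r. \<omega> s (x s) = x (Suc s))" for i r \<omega> x
  proof (induction r)
    case (Suc r)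
    have "(\<forall>s\<le>Suc r. X i s \<omega> = x s) \<longleftrightarrow> (\<forall>s\<le>r. X i s \<omega> = x s) \<and> \<omega> r (x r) = x (Suc r)"
      by (metis XS le_Suc_eq order_refl)
    also have "\<dots> \<longleftrightarrow> x 0 = i \<and> (\<forall>s<Suc r. \<omega> s (x s) = x (Suc s))"
      unfolding Suc by (auto simp only: less_Suc_eq)
    finally show ?case .
  qed (simp add: eq_commute)
  have prob_path: "prob {\<omega>. \<forall>s\<le>r. X i s \<omega> = x s} =
      (if x 0 = i then \<Prod>s<r. P $ x (Suc s) $ x s else 0)" for i r x
  proof (cases "x 0 = i")
    case True
    let ?A = "\<lambda>s. {f :: 'n \<Rightarrow> 'n. f (x s) = x (Suc s)}"
    have "prob {\<omega>. \<forall>s\<le>r. X i s \<omega> = x s} =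
        prob (prod_emb UNIV (\<lambda>_. measure_pmf q) {..<r} (PiE {..<r} ?A))"
    proof (rule arg_cong[where f = prob], rule set_eqI)
      fix \<omega>
      have "\<omega> \<in> prod_emb UNIV (\<lambda>_. measure_pmf q) {..<r} (PiE {..<r} ?A) \<longleftrightarrow>
          (\<forall>s<r. \<omega> s (x s) = x (Suc s))"
        by (simp add: prod_emb_iff PiE_iff Ball_def)
      then show "\<omega> \<in> {\<omega>. \<forall>s\<le>r. X i s \<omega> = x s} \<longleftrightarrow>
          \<omega> \<in> prod_emb UNIV (\<lambda>_. measure_pmf q) {..<r} (PiE {..<r} ?A)"
        using True by (simp only: mem_Collect_eq path simp_thms)
    qed
    also have "\<dots> = (\<Prod>s<r. measure q (?A s))"
      unfolding M_def by (rule q.measure_PiM_emb) auto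
    finally show ?thesis
      using True by (simp add: q)
  next
    case False
    then have "{\<omega>. \<forall>s\<le>r. X i s \<omega> = x s} = {}"
      by (simp only: path) simp
    with False show ?thesis
      by (simp only: measure_empty if_False)
  qed
  have "markov_chain_from P i M (X i)" for i
    unfolding markov_chain_from_def
  proof (intro conjI allI impI)
    fix r x y
    assume pos: "prob {\<omega> \<in> space M. \<forall>s\<le>r. X i s \<omega> = x s} > 0"
    let ?x = "x(Suc r := y)"
    have "(X i (Suc r) \<omega> = y \<and> (\<forall>s\<le>r. X i s \<omega> = x s)) \<longleftrightarrow> (\<forall>s\<le>Suc r. X i s \<omega> = ?x s)" for \<omega>
    proof -
      have "(\<forall>s\<le>Suc r. X i s \<omega> = ?x s) \<longleftrightarrow>
          X i (Suc r) \<omega> = ?x (Suc r) \<and> (\<forall>s\<le>r. X i s \<omega> = ?x s)"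
        by (metis le_Suc_eq order_refl)
      also have "\<dots> \<longleftrightarrow> X i (Suc r) \<omega> = y \<and> (\<forall>s\<le>r. X i s \<omega> = x s)"
        by simp
      finally show ?thesis ..
    qed
    then have "prob {\<omega>. X i (Suc r) \<omega> = y \<and> (\<forall>s\<le>r. X i s \<omega> = x s)} =
        prob {\<omega>. \<forall>s\<le>Suc r. X i s \<omega> = ?x s}"
      by (simp only:)
    also have "\<dots> = P $ y $ x r * prob {\<omega>. \<forall>s\<le>r. X i s \<omega> = x s}"
      unfolding prob_path by (auto intro!: prod.cong)
    finally show "\<P>(\<omega> in M. X i (Suc r) \<omega> = y \<bar> \<forall>s\<le>r. X i s \<omega> = x s) = P $ y $ x r"
      using pos by (simp add: cond_prob_def)
  qed (use prob_space_axioms meas in auto)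
  then show ?thesis
    by blast
qed

end

theory Submission
  imports Defs
begin

text \<open>
  Let \<open>g\<close> and \<open>h\<close> be the row vectors that agree with \<open>\<tau>\<close> off \<open>S\<close> and on \<open>S\<close>, respectively, and vanish elsewhere.
  First-step analysis reads \<open>g + h = 1 + g P\<close>, that is \<open>g (I - P + \<Omega>) = c 1 - h\<close> with \<open>c = 1 + g \<pi>\<close>. Since
  \<open>1 Z = 1\<close>, multiplication by \<open>Z\<close> gives \<open>g = c 1 - h Z\<close>; its entries on \<open>S\<close>, where \<open>g = 0\<close>, determine \<open>c\<close>,
  and those off \<open>S\<close> are the claim. The times are finite because stationarity gives
  \<open>\<Sum>k\<in>S. \<pi> k * \<tau> k \<le> 1\<close> and, by first-step analysis, finiteness of \<open>\<tau>\<close> propagates along transitions.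
\<close>

section \<open>Consequences of irreducibility\<close>

text \<open>By induction on \<open>r\<close>, column \<open>k\<close> of the powers of
  \<open>P\<close> has positive entries only in rows from \<open>A\<close>. Below, \<open>A\<close>
  is the support of \<open>\<pi>\<close>, a set of maximizers, or the set of states with finite mean
  time.\<close>

lemma irreducible_closed_set_eq_UNIV:
  fixes P :: "real^'n^'n"
  assumes st: "stochastic_matrix P" and irr: "irreducible_chain P"
    and A: "k \<in> A" and closed: "\<And>k l. k \<in> A \<Longrightarrow> 0 < P $ l $ k \<Longrightarrow> l \<in> A"
  shows "A = UNIV"
proof -
  have nonneg: "0 \<le> P $ l $ j" for l j
    using st by (simp add: stochastic_matrix_def)
  have "0 \<le> matrix_power P r $ l $ k \<and> (0 < matrix_power P r $ l $ k \<longrightarrow> l \<in> A)" for r l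
  proof (induction r arbitrary: l)
    case 0
    show ?case using A by (simp add: matrix_power_def mat_def)
  next
    case (Suc r)
    have eq: "matrix_power P (Suc r) $ l $ k = (\<Sum>m\<in>UNIV. P $ l $ m * matrix_power P r $ m $ k)"
      by (simp add: matrix_power_def matrix_matrix_mult_def)
    have "l \<in> A" if "0 < matrix_power P (Suc r) $ l $ k"
    proof -
      have "\<exists>m. 0 < P $ l $ m * matrix_power P r $ m $ k"
        using that unfolding eq by (meson linorder_not_less sum_nonpos)
      then obtain m where "0 < P $ l $ m * matrix_power P r $ m $ k" ..
      then have "0 < P $ l $ m" "0 < matrix_power P r $ m $ k"
        using nonneg[of l m] Suc.IH[of m] by (auto simp: zero_less_mult_iff)
      with Suc.IH[of m] closed show ?thesis by blast
    qed
    moreover have "0 \<le> matrix_power P (Suc r) $ l $ k"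
      unfolding eq using nonneg Suc.IH by (simp add: sum_nonneg)
    ultimately show ?case by blast
  qed
  with irr show ?thesis
    unfolding irreducible_chain_def by blast
qed

text \<open>The support of \<open>\<pi>\<close> is nonempty, as the total mass is 1, and closed
  under transitions, as \<open>\<pi> $ l \<ge> P $ l $ k * \<pi> $ k\<close>.\<close>

lemma invariant_distribution_pos:
  fixes P :: "real^'n^'n"
  assumes st: "stochastic_matrix P" and irr: "irreducible_chain P"
    and inv: "invariant_distribution P \<pi>"
  shows "0 < \<pi> $ i"
proof -
  have nn: "0 \<le> \<pi> $ k" "0 \<le> P $ l $ k" for k l
    using st inv by (auto simp: stochastic_matrix_def invariant_distribution_def)
  have "\<exists>k. 0 < \<pi> $ k"
  proof (rule ccontr)
    assume "\<not> ?thesis"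
    then have "(\<Sum>k\<in>UNIV. \<pi> $ k) \<le> 0"
      by (intro sum_nonpos) (simp add: not_less)
    with inv show False by (simp add: invariant_distribution_def)
  qed
  then obtain k where k: "k \<in> {k. 0 < \<pi> $ k}" by blast
  have "{k. 0 < \<pi> $ k} = UNIV"
  proof (rule irreducible_closed_set_eq_UNIV[OF st irr k])
    fix k l assume *: "k \<in> {k. 0 < \<pi> $ k}" "0 < P $ l $ k"
    have "\<pi> $ l = (\<Sum>m\<in>UNIV. P $ l $ m * \<pi> $ m)"
      using inv by (simp add: invariant_distribution_def matrix_vector_mult_def vec_eq_iff)
    also have "\<dots> \<ge> P $ l $ k * \<pi> $ k"
      by (rule member_le_sum) (auto simp: nn)
    finally show "l \<in> {k. 0 < \<pi> $ k}"
      using * by (smt (verit) mem_Collect_eq mult_pos_pos)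
  qed
  then show ?thesis by blast
qed

text \<open>Maximum principle: \<open>w $ k\<close> is the mean of \<open>w\<close> with the weights
  in column \<open>k\<close>, so where it is maximal, \<open>w\<close> is also maximal at every
  one-step successor of \<open>k\<close>.\<close>

lemma left_fixed_vector_constant:
  fixes P :: "real^'n^'n"
  assumes st: "stochastic_matrix P" and irr: "irreducible_chain P" and w: "w v* P = w"
  shows "w $ i = w $ j"
proof -
  define m where "m = Max (range (($) w))"
  have le: "w $ k \<le> m" for k
    unfolding m_def by (rule Max_ge) auto
  have "m \<in> range (($) w)"
    unfolding m_def by (rule Max_in) auto
  then obtain k where k: "k \<in> {k. w $ k = m}" by auto
  have "{k. w $ k = m} = UNIV"
  proof (rule irreducible_closed_set_eq_UNIV[OF st irr k])
    fix k l assume *: "k \<in> {k. w $ k = m}" "0 < P $ l $ k"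
    have nn: "0 \<le> P $ q $ k" for q
      using st by (simp add: stochastic_matrix_def)
    have "(w v* P) $ k = (\<Sum>q\<in>UNIV. P $ q $ k * w $ q)"
      by (simp add: vector_matrix_mult_def mult.commute)
    then have "(\<Sum>q\<in>UNIV. P $ q $ k * w $ q) = m"
      using * w by simp
    moreover have "(\<Sum>q\<in>UNIV. P $ q $ k * m) = m"
      using st by (simp add: stochastic_matrix_def flip: sum_distrib_right)
    ultimately have "(\<Sum>q\<in>UNIV. P $ q $ k * (m - w $ q)) = 0"
      by (simp add: right_diff_distrib sum_subtractf)
    then have "P $ l $ k * (m - w $ l) = 0"
      by (subst (asm) sum_nonneg_eq_0_iff) (auto simp: nn le)
    with * show "l \<in> {k. w $ k = m}" by auto
  qed
  then show ?thesis by (metis (mono_tags) UNIV_I mem_Collect_eq)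
qed

section \<open>Invertibility of I - P + \<Omega>\<close>

lemma vector_mult_deviation:
  fixes P :: "real^'n^'n"
  shows "(w v* (mat 1 - P + (\<chi> i j. \<pi> $ i))) $ j = w $ j - (w v* P) $ j + (\<Sum>k\<in>UNIV. w $ k * \<pi> $ k)"
proof -
  have "(w v* (mat 1 - P + (\<chi> i j. \<pi> $ i))) $ j =
      (w v* mat 1) $ j - (w v* P) $ j + (\<Sum>k\<in>UNIV. w $ k * \<pi> $ k)"
    by (simp add: vector_matrix_mult_def algebra_simps sum.distrib sum_subtractf)
  then show ?thesis by simp
qed

text \<open>No nonzero row vector is annihilated: pairing \<open>w v* ?A = 0\<close> with
  \<open>\<pi>\<close> cancels \<open>w\<close> against \<open>w v* P\<close> and leaves
  \<open>c = 0\<close> for the \<open>\<pi>\<close>-mean \<open>c\<close> of \<open>w\<close>. Then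
  \<open>w\<close> is fixed by \<open>P\<close>, hence constant, hence equal to
  \<open>c\<close>.\<close>

lemma invertible_deviation:
  fixes P :: "real^'n^'n"
  assumes st: "stochastic_matrix P" and irr: "irreducible_chain P"
    and inv: "invariant_distribution P \<pi>"
  shows "invertible (mat 1 - P + (\<chi> i j. \<pi> $ i))"
proof -
  let ?A = "mat 1 - P + (\<chi> i j. \<pi> $ i)"
  have sum1: "(\<Sum>k\<in>UNIV. \<pi> $ k) = 1" and fixp: "(\<Sum>j\<in>UNIV. P $ k $ j * \<pi> $ j) = \<pi> $ k" for k
    using inv by (auto simp: invariant_distribution_def matrix_vector_mult_def vec_eq_iff)
  have "w = 0" if w: "w v* ?A = 0" for w
  proof -
    define c where "c = (\<Sum>k\<in>UNIV. w $ k * \<pi> $ k)"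
    have eq: "w $ j - (w v* P) $ j + c = 0" for j
      unfolding c_def vector_mult_deviation[symmetric] by (simp add: w)
    have "(\<Sum>j\<in>UNIV. (w v* P) $ j * \<pi> $ j) = (\<Sum>j\<in>UNIV. \<Sum>k\<in>UNIV. w $ k * (P $ k $ j * \<pi> $ j))"
      by (simp add: vector_matrix_mult_def sum_distrib_left sum_distrib_right mult_ac)
    also have "\<dots> = (\<Sum>k\<in>UNIV. w $ k * (\<Sum>j\<in>UNIV. P $ k $ j * \<pi> $ j))"
      by (subst sum.swap) (simp add: sum_distrib_left)
    finally have wP: "(\<Sum>j\<in>UNIV. (w v* P) $ j * \<pi> $ j) = c"
      by (simp add: fixp c_def)
    have "(\<Sum>j\<in>UNIV. (w $ j - (w v* P) $ j + c) * \<pi> $ j) = c - c + c * 1"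
      by (simp only: distrib_right left_diff_distrib sum.distrib sum_subtractf wP c_def[symmetric]
          sum_distrib_left[symmetric] sum1)
    then have "c = 0" by (simp add: eq)
    then have "w v* P = w" using eq by (simp add: vec_eq_iff)
    then have const: "w $ i = w $ j" for i j
      by (rule left_fixed_vector_constant[OF st irr])
    have "w $ i = c" for i
    proof -
      have "c = (\<Sum>k\<in>UNIV. w $ i * \<pi> $ k)"
        unfolding c_def by (intro sum.cong refl) (metis const)
      then show ?thesis by (simp add: sum1 flip: sum_distrib_left)
    qed
    with \<open>c = 0\<close> show ?thesis by (simp add: vec_eq_iff)
  qed
  \<comment> \<open>The kernel criterion concerns column vectors, so it is applied to the
    transpose.\<close>
  then have "\<exists>B. B ** transpose ?A = mat 1"
    unfolding matrix_left_invertible_ker by (simp add: transpose_matrix_vector)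
  then obtain B where "B ** transpose ?A = mat 1" ..
  then have "?A ** transpose B = mat 1"
    by (metis matrix_transpose_mul transpose_mat transpose_transpose)
  then show ?thesis
    by (auto simp: invertible_right_inverse)
qed

section \<open>Probabilities of avoiding S\<close>

text \<open>Probability of avoiding \<open>S\<close> at times 1 to \<open>r\<close> from
  \<open>i\<close>, expressed through \<open>P\<close> alone. Time 0 is unconstrained, so
  \<open>i\<close> may lie in \<open>S\<close>, as return times require.\<close>

primrec avoid_prob :: "real^'n^'n \<Rightarrow> 'n set \<Rightarrow> nat \<Rightarrow> 'n \<Rightarrow> real" where
  "avoid_prob P S 0 i = 1"
| "avoid_prob P S (Suc r) i = (\<Sum>k\<in>-S. P $ k $ i * avoid_prob P S r k)"

lemma avoid_prob_nonneg:
  assumes "stochastic_matrix P"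
  shows "0 \<le> avoid_prob P S r i"
  using assms by (induction r arbitrary: i) (auto simp: stochastic_matrix_def intro!: sum_nonneg)

text \<open>The Markov property in product form, free of the positivity condition: for a null past
  both sides vanish.\<close>

lemma markov_chain_path_Suc:
  assumes mc: "markov_chain_from P i M X"
  shows "\<P>(\<omega> in M. \<forall>s\<le>Suc r. X s \<omega> = (x(Suc r := y)) s) = P $ y $ x r * \<P>(\<omega> in M. \<forall>s\<le>r. X s \<omega> = x s)"
proof -
  interpret prob_space M using mc by (simp add: markov_chain_from_def)
  have [measurable]: "X s \<in> measurable M (count_space UNIV)" for s
    using mc by (simp add: markov_chain_from_def)
  have eq: "(\<forall>s\<le>Suc r. X s \<omega> = (x(Suc r := y)) s) \<longleftrightarrow> X (Suc r) \<omega> = y \<and> (\<forall>s\<le>r. X s \<omega> = x s)" for \<omega>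
    by (auto simp: le_Suc_eq)
  show ?thesis
  proof (cases "\<P>(\<omega> in M. \<forall>s\<le>r. X s \<omega> = x s) > 0")
    case True
    then have "\<P>(\<omega> in M. X (Suc r) \<omega> = y \<bar> \<forall>s\<le>r. X s \<omega> = x s) = P $ y $ x r"
      using mc unfolding markov_chain_from_def by blast
    with True show ?thesis
      unfolding eq by (simp add: cond_prob_def field_simps)
  next
    case False
    then have 0: "\<P>(\<omega> in M. \<forall>s\<le>r. X s \<omega> = x s) = 0"
      by (simp add: zero_less_measure_iff)
    have "\<P>(\<omega> in M. X (Suc r) \<omega> = y \<and> (\<forall>s\<le>r. X s \<omega> = x s)) \<le> \<P>(\<omega> in M. \<forall>s\<le>r. X s \<omega> = x s)"
      by (rule finite_measure_mono) auto
    with 0 show ?thesis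
      unfolding eq by (simp add: measure_le_0_iff)
  qed
qed

text \<open>\<open>avoid_prob\<close> unfolds from the front, while the Markov property extends a
  path at its end. An arbitrary past up to \<open>r\<close> reconciles the two: the induction on
  \<open>m\<close> absorbs the state at time \<open>Suc r\<close> into the past.\<close>

lemma markov_chain_path_avoid:
  assumes mc: "markov_chain_from P i M X"
  shows "\<P>(\<omega> in M. (\<forall>s\<le>r. X s \<omega> = x s) \<and> (\<forall>s\<in>{r<..r+m}. X s \<omega> \<notin> S)) =
    \<P>(\<omega> in M. \<forall>s\<le>r. X s \<omega> = x s) * avoid_prob P S m (x r)"
proof (induction m arbitrary: r x)
  case (Suc m)
  interpret prob_space M using mc by (simp add: markov_chain_from_def)
  have [measurable]: "X s \<in> measurable M (count_space UNIV)" for s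
    using mc by (simp add: markov_chain_from_def)
  define B where "B y = {\<omega> \<in> space M. (\<forall>s\<le>Suc r. X s \<omega> = (x(Suc r := y)) s) \<and>
    (\<forall>s\<in>{Suc r<..Suc r + m}. X s \<omega> \<notin> S)}" for y
  have interval: "{r<..r + Suc m} = insert (Suc r) {Suc r<..Suc r + m}"
    by auto
  have "{\<omega> \<in> space M. (\<forall>s\<le>r. X s \<omega> = x s) \<and> (\<forall>s\<in>{r<..r + Suc m}. X s \<omega> \<notin> S)} = (\<Union>y\<in>-S. B y)"
    unfolding interval B_def by (auto simp: le_Suc_eq)
  then have "\<P>(\<omega> in M. (\<forall>s\<le>r. X s \<omega> = x s) \<and> (\<forall>s\<in>{r<..r + Suc m}. X s \<omega> \<notin> S)) = prob (\<Union>y\<in>-S. B y)"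
    by simp
  also have "\<dots> = (\<Sum>y\<in>-S. prob (B y))"
  proof (rule finite_measure_finite_Union)
    show "B ` (- S) \<subseteq> events"
      unfolding B_def by auto
    show "disjoint_family_on B (- S)"
      unfolding B_def disjoint_family_on_def by force
  qed simp
  \<comment> \<open>The induction hypothesis is used for the past \<open>x(Suc r := y)\<close>,
    which ends in \<open>y\<close>.\<close>
  also have "\<dots> = (\<Sum>y\<in>-S. P $ y $ x r * \<P>(\<omega> in M. \<forall>s\<le>r. X s \<omega> = x s) * avoid_prob P S m y)"
    unfolding B_def Suc.IH markov_chain_path_Suc[OF mc] by simp
  also have "\<dots> = \<P>(\<omega> in M. \<forall>s\<le>r. X s \<omega> = x s) * avoid_prob P S (Suc m) (x r)"
    by (simp add: sum_distrib_left sum_distrib_right mult_ac)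
  finally show ?case .
qed simp

lemma markov_chain_avoid:
  assumes mc: "markov_chain_from P i M X"
  shows "\<P>(\<omega> in M. \<forall>s\<in>{1..r}. X s \<omega> \<notin> S) = avoid_prob P S r i"
proof -
  interpret prob_space M using mc by (simp add: markov_chain_from_def)
  have [measurable]: "X s \<in> measurable M (count_space UNIV)" for s
    using mc by (simp add: markov_chain_from_def)
  have start: "AE \<omega> in M. X 0 \<omega> = i"
    using mc by (simp add: markov_chain_from_def)
  have interval: "{0<..0 + r} = {1..r}" by auto
  \<comment> \<open>The almost sure start in \<open>i\<close> is recorded as a past consisting of
    time 0 only.\<close>
  have "\<P>(\<omega> in M. \<forall>s\<in>{1..r}. X s \<omega> \<notin> S) =
      \<P>(\<omega> in M. (\<forall>s\<le>0. X s \<omega> = i) \<and> (\<forall>s\<in>{0<..0 + r}. X s \<omega> \<notin> S))"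
    unfolding interval by (rule finite_measure_eq_AE) (use start in auto)
  also have "\<dots> = \<P>(\<omega> in M. \<forall>s\<le>0. X s \<omega> = i) * avoid_prob P S r i"
    by (rule markov_chain_path_avoid[OF mc, of 0 "\<lambda>_. i"])
  also have "\<P>(\<omega> in M. \<forall>s\<le>0. X s \<omega> = i) = 1"
    using start by (subst prob_Collect_eq_1) auto
  finally show ?thesis by simp
qed

section \<open>Mean times as series and first-step analysis\<close>

text \<open>Tail-sum form: for a first visit at time \<open>L\<close>, exactly the indices
  \<open>r = 0, ..., L - 1\<close> contribute 1; without a visit every term is 1 and the series
  diverges.\<close>

lemma first_visit_eq_suminf:
  "first_visit S x = (\<Sum>r. if \<forall>s\<in>{1..r}. x s \<notin> S then 1 else 0)"
proof (cases "\<exists>r\<ge>1. x r \<in> S")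
  case True
  define L where "L = (LEAST r. 1 \<le> r \<and> x r \<in> S)"
  have L: "1 \<le> L" "x L \<in> S"
    using LeastI_ex[OF True] by (auto simp: L_def)
  have before: "x s \<notin> S" if "1 \<le> s" "s < L" for s
    using that not_less_Least unfolding L_def by blast
  have "(\<forall>s\<in>{1..r}. x s \<notin> S) \<longleftrightarrow> r < L" for r
    using L before by (auto simp: not_less[symmetric])
  then have "(\<Sum>r. if \<forall>s\<in>{1..r}. x s \<notin> S then 1 else 0 :: ennreal) = (\<Sum>r. if r < L then 1 else 0)"
    by presburger
  also have "\<dots> = (\<Sum>r<L. if r < L then 1 else 0)"
    by (rule suminf_finite) auto
  finally show ?thesis
    using True by (simp add: first_visit_def L_def)
next
  case False
  then have "(\<Sum>r. if \<forall>s\<in>{1..r}. x s \<notin> S then 1 else 0 :: ennreal) = (\<Sum>r. 1)"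
    by (intro suminf_cong) auto
  also have "\<dots> = \<infinity>"
    by (simp add: suminf_eq_SUP ennreal_SUP_of_nat_eq_top)
  finally show ?thesis
    unfolding first_visit_def if_not_P[OF False] by simp
qed

text \<open>The tail sum integrates term by term since its terms are nonnegative. The mean thus
  depends only on \<open>P\<close>, \<open>S\<close> and \<open>i\<close>, not on the choice of
  \<open>M\<close> and \<open>X\<close>.\<close>

lemma mean_time_eq_suminf:
  assumes mc: "markov_chain_from P i M X"
  shows "mean_time M X S = (\<Sum>r. ennreal (avoid_prob P S r i))"
proof -
  interpret prob_space M using mc by (simp add: markov_chain_from_def)
  have [measurable]: "X s \<in> measurable M (count_space UNIV)" for s
    using mc by (simp add: markov_chain_from_def)
  have "mean_time M X S = (\<Sum>r. \<integral>\<^sup>+\<omega>. (if \<forall>s\<in>{1..r}. X s \<omega> \<notin> S then 1 else 0) \<partial>M)"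
    unfolding mean_time_def first_visit_eq_suminf by (rule nn_integral_suminf) measurable
  also have "\<dots> = (\<Sum>r. ennreal (avoid_prob P S r i))"
  proof (rule suminf_cong)
    fix r
    let ?B = "{\<omega> \<in> space M. \<forall>s\<in>{1..r}. X s \<omega> \<notin> S}"
    have "(\<integral>\<^sup>+\<omega>. (if \<forall>s\<in>{1..r}. X s \<omega> \<notin> S then 1 else 0) \<partial>M) = (\<integral>\<^sup>+\<omega>. indicator ?B \<omega> \<partial>M)"
      by (intro nn_integral_cong) (auto simp: indicator_def)
    also have "\<dots> = emeasure M ?B"
      by (rule nn_integral_indicator) measurable
    finally show "(\<integral>\<^sup>+\<omega>. (if \<forall>s\<in>{1..r}. X s \<omega> \<notin> S then 1 else 0) \<partial>M) = ennreal (avoid_prob P S r i)"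
      by (simp only: emeasure_eq_measure markov_chain_avoid[OF mc])
  qed
  finally show ?thesis .
qed

text \<open>The term \<open>r = 0\<close> of the series gives the 1; in the others the recursion of
  \<open>avoid_prob\<close> splits off the first step. In \<open>ennreal\<close> the sums may be
  exchanged before finiteness is known.\<close>

lemma mean_time_first_step:
  assumes st: "stochastic_matrix P" and mc: "\<And>i. markov_chain_from P i (M i) (X i)"
  shows "mean_time (M i) (X i) S = 1 + (\<Sum>k\<in>-S. ennreal (P $ k $ i) * mean_time (M k) (X k) S)"
proof -
  have nn: "0 \<le> P $ k $ i" for k
    using st by (simp add: stochastic_matrix_def)
  note nn' = avoid_prob_nonneg[OF st]
  have "(\<Sum>r. ennreal (avoid_prob P S r i)) =
      ennreal (avoid_prob P S 0 i) + (\<Sum>r. ennreal (avoid_prob P S (Suc r) i))"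
    by (subst suminf_offset[where i = 1]) (auto simp: ac_simps)
  also have "(\<Sum>r. ennreal (avoid_prob P S (Suc r) i)) =
      (\<Sum>r. \<Sum>k\<in>-S. ennreal (P $ k $ i) * ennreal (avoid_prob P S r k))"
    by (simp add: sum_ennreal[symmetric] nn nn' ennreal_mult)
  also have "\<dots> = (\<Sum>k\<in>-S. \<Sum>r. ennreal (P $ k $ i) * ennreal (avoid_prob P S r k))"
    by (rule suminf_sum) simp
  finally show ?thesis
    by (simp add: mean_time_eq_suminf[OF mc])
qed

section \<open>Finiteness of the mean times\<close>

text \<open>
  One half of Kac's formula: \<open>\<Sum>k\<in>S. \<pi> k * avoid_prob P S r k\<close> is the decrease of
  \<open>\<Sum>i. \<pi> i * avoid_prob P S r i\<close> from \<open>r\<close> to \<open>r + 1\<close>, so it telescopes.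
\<close>

lemma sum_invariant_avoid_prob_le_1:
  fixes P :: "real^'n^'n"
  assumes st: "stochastic_matrix P" and inv: "invariant_distribution P \<pi>"
  shows "(\<Sum>r<m. \<Sum>k\<in>S. \<pi> $ k * avoid_prob P S r k) \<le> 1"
proof -
  define a where "a r = (\<Sum>i\<in>UNIV. \<pi> $ i * avoid_prob P S r i)" for r
  have nn: "0 \<le> \<pi> $ k" and sum1: "(\<Sum>k\<in>UNIV. \<pi> $ k) = 1"
    and fixp: "(\<Sum>j\<in>UNIV. P $ k $ j * \<pi> $ j) = \<pi> $ k" for k
    using inv by (auto simp: invariant_distribution_def matrix_vector_mult_def vec_eq_iff)
  have step: "a r - a (Suc r) = (\<Sum>k\<in>S. \<pi> $ k * avoid_prob P S r k)" for r
  proof -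
    have "a (Suc r) = (\<Sum>i\<in>UNIV. \<Sum>k\<in>-S. P $ k $ i * \<pi> $ i * avoid_prob P S r k)"
      by (simp add: a_def sum_distrib_left mult_ac)
    also have "\<dots> = (\<Sum>k\<in>-S. (\<Sum>i\<in>UNIV. P $ k $ i * \<pi> $ i) * avoid_prob P S r k)"
      by (subst sum.swap) (simp add: sum_distrib_right)
    finally have "a (Suc r) = (\<Sum>k\<in>-S. \<pi> $ k * avoid_prob P S r k)"
      by (simp add: fixp)
    moreover have "a r = (\<Sum>k\<in>S. \<pi> $ k * avoid_prob P S r k) + (\<Sum>k\<in>-S. \<pi> $ k * avoid_prob P S r k)"
      unfolding a_def by (subst sum.union_disjoint[symmetric]) (auto simp: Compl_partition)
    ultimately show ?thesis by simp
  qed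
  have "(\<Sum>r<m. \<Sum>k\<in>S. \<pi> $ k * avoid_prob P S r k) = a 0 - a m"
    by (simp add: step[symmetric] sum_lessThan_telescope')
  also have "\<dots> \<le> a 0"
    unfolding a_def by (simp add: sum_nonneg nn avoid_prob_nonneg[OF st])
  also have "a 0 = 1"
    by (simp add: a_def sum1)
  finally show ?thesis .
qed

text \<open>The telescoped bound has nonnegative terms, so for a single \<open>k\<close> in
  \<open>S\<close> every partial sum of the series is at most \<open>1 / \<pi> $ k\<close>.\<close>

lemma mean_return_time_finite:
  assumes st: "stochastic_matrix P" and irr: "irreducible_chain P"
    and inv: "invariant_distribution P \<pi>" and mc: "markov_chain_from P k M X" and k: "k \<in> S"
  shows "mean_time M X S < \<infinity>"
proof -
  note pos = invariant_distribution_pos[OF st irr inv] and nn = avoid_prob_nonneg[OF st]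
  have "(\<Sum>r<m. avoid_prob P S r k) \<le> 1 / \<pi> $ k" for m
  proof -
    have "(\<Sum>r<m. \<pi> $ k * avoid_prob P S r k) \<le> (\<Sum>r<m. \<Sum>k\<in>S. \<pi> $ k * avoid_prob P S r k)"
      by (intro sum_mono member_le_sum[OF k]) (simp_all add: nn less_imp_le pos)
    also have "\<dots> \<le> 1"
      by (rule sum_invariant_avoid_prob_le_1[OF st inv])
    finally show ?thesis
      using pos[of k] by (simp add: field_simps flip: sum_distrib_left)
  qed
  then have "(\<Sum>r<m. ennreal (avoid_prob P S r k)) \<le> ennreal (1 / \<pi> $ k)" for m
    by (simp add: sum_ennreal nn ennreal_leI)
  then have "mean_time M X S \<le> ennreal (1 / \<pi> $ k)"
    unfolding mean_time_eq_suminf[OF mc] by (intro suminf_le_const) auto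
  then show ?thesis
    by (rule order_le_less_trans) simp
qed

lemma mean_time_finite:
  assumes st: "stochastic_matrix P" and irr: "irreducible_chain P"
    and inv: "invariant_distribution P \<pi>" and mc: "\<And>i. markov_chain_from P i (M i) (X i)"
    and S: "S \<noteq> {}"
  shows "mean_time (M i) (X i) S < \<infinity>"
proof -
  let ?F = "{i. mean_time (M i) (X i) S < \<infinity>}"
  note return = mean_return_time_finite[OF st irr inv mc]
  obtain k where k: "k \<in> ?F"
    using S return by blast
  have "?F = UNIV"
  proof (rule irreducible_closed_set_eq_UNIV[OF st irr k])
    fix k l assume *: "k \<in> ?F" "0 < P $ l $ k"
    show "l \<in> ?F"
    \<comment> \<open>First-step analysis at \<open>k\<close> bounds the time from \<open>l\<close>
      only for \<open>l\<close> outside \<open>S\<close>; inside \<open>S\<close> it is a return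
      time, whose finiteness is already known.\<close>
    proof (cases "l \<in> S")
      case True
      then show ?thesis using return by blast
    next
      case False
      have "ennreal (P $ l $ k) * mean_time (M l) (X l) S \<le>
          (\<Sum>m\<in>-S. ennreal (P $ m $ k) * mean_time (M m) (X m) S)"
        by (rule member_le_sum) (use False in auto)
      also have "\<dots> \<le> mean_time (M k) (X k) S"
        by (subst (2) mean_time_first_step[OF st mc]) simp
      finally have "ennreal (P $ l $ k) * mean_time (M l) (X l) S < \<infinity>"
        using *(1) by (simp add: order_le_less_trans)
      then show ?thesis
        using *(2) by (auto simp: ennreal_mult_less_top ennreal_eq_0_iff not_le)
    qed
  qed
  then show ?thesis by blast
qed

section \<open>Solving the first-step equations by means of Z\<close>

theorem theorem5p2:
  fixes P :: "real^'n^'n" and \<pi> :: "real^'n" and Z :: "real^'n^'n"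
    and M :: "'n \<Rightarrow> 'w measure" and X :: "'n \<Rightarrow> nat \<Rightarrow> 'w \<Rightarrow> 'n"
    and S :: "'n set" and \<tau> :: "'n \<Rightarrow> real"
  assumes "stochastic_matrix P" and "irreducible_chain P"
    and "invariant_distribution P \<pi>"
    and "Z = fundamental_matrix P \<pi>"
    and "\<And>i. markov_chain_from P i (M i) (X i)"
    and "\<And>i. \<tau> i = enn2real (mean_time (M i) (X i) S)"
  shows "(S \<noteq> {} \<longrightarrow> (\<forall>i. mean_time (M i) (X i) S < \<infinity>)) \<and>
    (\<forall>i j. i \<notin> S \<longrightarrow> j \<in> S \<longrightarrow> \<tau> i = (\<Sum>k\<in>S. (Z $ k $ j - Z $ k $ i) * \<tau> k)) \<and>
    (\<forall>j\<in>S. \<forall>j'\<in>S. (\<Sum>k\<in>S. Z $ k $ j * \<tau> k) = (\<Sum>k\<in>S. Z $ k $ j' * \<tau> k))"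
proof (cases "S = {}")
  case True
  \<comment> \<open>Every claim asks for a nonempty \<open>S\<close> or a state in \<open>S\<close>,
    so all are vacuous here.\<close>
  then show ?thesis by simp
next
  case False
  note st = assms(1) and irr = assms(2) and inv = assms(3) and mc = assms(5) and \<tau> = assms(6)
  let ?A = "mat 1 - P + (\<chi> i j. \<pi> $ i)"
  have fin: "mean_time (M i) (X i) S < \<infinity>" for i
    by (rule mean_time_finite[OF st irr inv mc False])
  have nn: "0 \<le> P $ k $ i" and col: "(\<Sum>k\<in>UNIV. P $ k $ i) = 1" for k i
    using st by (auto simp: stochastic_matrix_def)
  have \<tau>_nn: "0 \<le> \<tau> i" and mean: "mean_time (M i) (X i) S = ennreal (\<tau> i)" for i
    using fin[of i] by (auto simp: \<tau>)
  \<comment> \<open>Finiteness lets the first-step identity pass from \<open>ennreal\<close> to the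
    reals.\<close>
  have step: "\<tau> i = 1 + (\<Sum>k\<in>-S. P $ k $ i * \<tau> k)" for i
  proof -
    have "ennreal (\<tau> i) = 1 + (\<Sum>k\<in>-S. ennreal (P $ k $ i * \<tau> k))"
      using mean_time_first_step[OF st mc, of i S] by (simp add: mean ennreal_mult nn \<tau>_nn)
    also have "\<dots> = ennreal (1 + (\<Sum>k\<in>-S. P $ k $ i * \<tau> k))"
      by (simp add: sum_ennreal nn \<tau>_nn sum_nonneg)
    finally show ?thesis
      by (subst (asm) ennreal_inj) (simp_all add: \<tau>_nn nn sum_nonneg)
  qed
  \<comment> \<open>\<open>matrix_inv\<close> chooses a two-sided inverse; invertibility guarantees
    that the choice succeeds.\<close>
  have AZ: "?A ** Z = mat 1"
    using invertible_deviation[OF st irr inv]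
    unfolding assms(4) fundamental_matrix_def matrix_inv_def invertible_def
    by (rule someI2_ex) blast
  define g :: "real^'n" where "g = (\<chi> k. if k \<in> S then 0 else \<tau> k)"
  define h :: "real^'n" where "h = (\<chi> k. if k \<in> S then \<tau> k else 0)"
  define c where "c = 1 + (\<Sum>k\<in>UNIV. g $ k * \<pi> $ k)"
  have "g v* ?A = c *\<^sub>R 1 - h"
  proof (rule vec_eq_iff[THEN iffD2], rule allI)
    fix j
    \<comment> \<open>As \<open>g\<close> vanishes on \<open>S\<close>, multiplying it by
      \<open>P\<close> produces exactly the sum over \<open>-S\<close> in \<open>step\<close>, for
      \<open>j\<close> in \<open>S\<close> as well as outside.\<close>
    have "(g v* P) $ j = (\<Sum>k\<in>-S. P $ k $ j * \<tau> k)"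
      unfolding vector_matrix_mult_def
      by (simp add: g_def) (rule sum.mono_neutral_cong_right, auto)
    then have "(g v* P) $ j = \<tau> j - 1" using step[of j] by simp
    then show "(g v* ?A) $ j = (c *\<^sub>R 1 - h) $ j"
      unfolding vector_mult_deviation c_def by (simp add: g_def h_def)
  qed
  \<comment> \<open>The columns of \<open>P\<close> and the vector \<open>\<pi>\<close> all sum to
    1, so the all-ones row vector is fixed by \<open>?A\<close> and therefore by
    \<open>Z\<close>.\<close>
  moreover have "1 v* ?A = 1"
    using inv unfolding vec_eq_iff vector_mult_deviation
    by (simp add: vector_matrix_mult_def col invariant_distribution_def)
  moreover have "(w v* ?A) v* Z = w" for w
    by (simp add: vector_matrix_mul_assoc AZ)
  ultimately have "(c *\<^sub>R 1 - h) v* Z = g" and "1 v* Z = 1"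
    by metis+
  then have "g = c *\<^sub>R 1 - h v* Z"
    by (simp add: vector_matrix_mult_diff_distrib scaleR_vector_matrix_assoc)
  moreover have "(h v* Z) $ i = (\<Sum>k\<in>S. Z $ k $ i * \<tau> k)" for i
    by (auto simp: vector_matrix_mult_def h_def intro: sum.mono_neutral_cong_right)
  ultimately have g: "g $ i = c - (\<Sum>k\<in>S. Z $ k $ i * \<tau> k)" for i
    by simp
  have "(\<Sum>k\<in>S. Z $ k $ j * \<tau> k) = c" if "j \<in> S" for j
    using g[of j] that by (simp add: g_def)
  moreover have "\<tau> i = c - (\<Sum>k\<in>S. Z $ k $ i * \<tau> k)" if "i \<notin> S" for i
    using g[of i] that by (simp add: g_def)
  ultimately show ?thesis
    using fin by (simp add: left_diff_distrib sum_subtractf)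
qed

end
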